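(* Let $H$ be a real Hilbert space, $T\colon H\to H$ a nonexpansive operator, $\alpha\ge2$, $\sigma>0$, $x^{-1},x^0\in H$, and let $(x^k)$ be generated by $$x^{k+1}=x^k+\frac{1}{k+\sigma}\big(T(x^k)-x^k\big)+\Big(1-\frac{\alpha}{k+\sigma}\Big)\big(T(x^k)-T(x^{k-1})\big),\qquad k\ge0.$$ Then $$x^{k+1}=\varepsilon_kv+(1-\varepsilon_k)T(x^k)\qquad\text{for all }k\ge0,$$ where $\varepsilon_k:=\dfrac{\alpha-1}{k+\sigma}$ and $v:=\dfrac{t_0}{\alpha-1}\big(x^0-T(x^{-1})\big)+T(x^{-1})$, with $t_0:=\sigma-1$.
   Context: $T$ is nonexpansive if $\|T(x)-T(y)\|\le\|x-y\|$ for all $x,y\in H$. *)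

theory Defs
  imports "HOL-Analysis.Analysis"
begin

definition nonexpansive :: "('a::real_normed_vector \<Rightarrow> 'a) \<Rightarrow> bool"
  where "nonexpansive T \<longleftrightarrow> (\<forall>x y. norm (T x - T y) \<le> norm (x - y))"

text \<open>
  Iterates are indexed by \<^typ>\<open>int\<close>, since the sequence starts at index \<open>-1\<close>; the values
  at indices below \<open>-1\<close> are irrelevant. The starting points \<open>x (-1)\<close> and \<open>x 0\<close> are
  unconstrained.
\<close>

definition generated_by ::
    "('a::real_inner \<Rightarrow> 'a) \<Rightarrow> real \<Rightarrow> real \<Rightarrow> (int \<Rightarrow> 'a) \<Rightarrow> bool"
  where "generated_by T \<alpha> \<sigma> x \<longleftrightarrow>
    (\<forall>k\<ge>0. x (k + 1) = x k + (1 / (of_int k + \<sigma>)) *\<^sub>R (T (x k) - x k)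
       + (1 - \<alpha> / (of_int k + \<sigma>)) *\<^sub>R (T (x k) - T (x (k - 1))))"

end

theory Submission
  imports Defs
begin

text \<open>
  The recursion conserves the vector \<open>(k + \<sigma> - 1) x k - (k + \<sigma> - \<alpha>) T (x (k - 1))\<close>.
  Multiplied by \<open>k + \<sigma>\<close>, the recursion reads
  \<open>(k + \<sigma>) x (k + 1) = (k + \<sigma> - 1) x k + T (x k) + (k + \<sigma> - \<alpha>) (T (x k) - T (x (k - 1)))\<close>;
  the coefficient of \<open>T (x k)\<close> is \<open>(k + 1) + \<sigma> - \<alpha>\<close>, so moving that term to the left leaves
  the vector at \<open>k + 1\<close> on the left and the vector at \<open>k\<close> on the right
  (\<open>generated_by_conserved_step\<close>). At \<open>k = 0\<close> the conserved vector is \<open>(\<alpha> - 1) v\<close>. Equating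
  its value at \<open>k + 1\<close> with \<open>(\<alpha> - 1) v\<close> and dividing by \<open>k + \<sigma>\<close> expresses \<open>x (k + 1)\<close> as
  the affine combination of the anchor \<open>v\<close> and \<open>T (x k)\<close>.
\<close>

lemma generated_by_conserved_step:
  assumes "generated_by T \<alpha> \<sigma> x" and "\<sigma> > 0" and "k \<ge> 0"
  shows "(of_int k + \<sigma>) *\<^sub>R x (k + 1) - (of_int k + 1 + \<sigma> - \<alpha>) *\<^sub>R T (x k)
       = (of_int k + \<sigma> - 1) *\<^sub>R x k - (of_int k + \<sigma> - \<alpha>) *\<^sub>R T (x (k - 1))"
proof -
  define s where "s = of_int k + \<sigma>"
  have "s > 0"
    using assms(2,3) by (simp add: s_def add_nonneg_pos)
  have "x (k + 1) = x k + (1 / s) *\<^sub>R (T (x k) - x k)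
      + (1 - \<alpha> / s) *\<^sub>R (T (x k) - T (x (k - 1)))"
    using assms(1,3) by (simp add: generated_by_def s_def)
  then have "s *\<^sub>R x (k + 1) = s *\<^sub>R x k + (s * (1 / s)) *\<^sub>R (T (x k) - x k)
      + (s * (1 - \<alpha> / s)) *\<^sub>R (T (x k) - T (x (k - 1)))"
    by (simp only: scaleR_add_right scaleR_scaleR)
  moreover have "s * (1 / s) = 1" "s * (1 - \<alpha> / s) = s - \<alpha>"
    using \<open>s > 0\<close> by (simp_all add: field_simps)
  ultimately have "s *\<^sub>R x (k + 1) = s *\<^sub>R x k + (T (x k) - x k)
      + (s - \<alpha>) *\<^sub>R (T (x k) - T (x (k - 1)))"
    by simp
  then have "s *\<^sub>R x (k + 1) - (s + 1 - \<alpha>) *\<^sub>R T (x k)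
      = (s - 1) *\<^sub>R x k - (s - \<alpha>) *\<^sub>R T (x (k - 1))"
    by (simp add: algebra_simps)
  then show ?thesis
    by (simp add: s_def algebra_simps)
qed

lemma generated_by_conserved:
  assumes "generated_by T \<alpha> \<sigma> x" and "\<sigma> > 0" and "k \<ge> 0"
  shows "(of_int k + \<sigma> - 1) *\<^sub>R x k - (of_int k + \<sigma> - \<alpha>) *\<^sub>R T (x (k - 1))
       = (\<sigma> - 1) *\<^sub>R x 0 - (\<sigma> - \<alpha>) *\<^sub>R T (x (-1))"
  using \<open>k \<ge> 0\<close>
proof (induction k rule: int_ge_induct)
  case base
  show ?case by simp
next
  case (step k)
  have "of_int (k + 1) + \<sigma> - 1 = of_int k + \<sigma>"
       "of_int (k + 1) + \<sigma> - \<alpha> = of_int k + 1 + \<sigma> - \<alpha>"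
    by simp_all
  then show ?case
    using generated_by_conserved_step[OF assms(1,2) step.hyps] step.IH
    by (simp only: add_diff_cancel_right')
qed

theorem proposition3p6:
  fixes T :: "'a::{real_inner, complete_space} \<Rightarrow> 'a"
    and \<alpha> \<sigma> :: real
    and x :: "int \<Rightarrow> 'a"
  assumes "nonexpansive T"
    and "\<alpha> \<ge> 2"
    and "\<sigma> > 0"
    and "generated_by T \<alpha> \<sigma> x"
  shows "let t\<^sub>0 = \<sigma> - 1;
             \<epsilon> = (\<lambda>k::int. (\<alpha> - 1) / (of_int k + \<sigma>));
             v = (t\<^sub>0 / (\<alpha> - 1)) *\<^sub>R (x 0 - T (x (-1))) + T (x (-1))
         in \<forall>k\<ge>0. x (k + 1) = \<epsilon> k *\<^sub>R v + (1 - \<epsilon> k) *\<^sub>R T (x k)"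
proof -
  define v where "v = ((\<sigma> - 1) / (\<alpha> - 1)) *\<^sub>R (x 0 - T (x (-1))) + T (x (-1))"
  have "(\<alpha> - 1) *\<^sub>R v = (\<sigma> - 1) *\<^sub>R (x 0 - T (x (-1))) + (\<alpha> - 1) *\<^sub>R T (x (-1))"
    using \<open>\<alpha> \<ge> 2\<close> by (simp add: v_def scaleR_add_right)
  then have v: "(\<alpha> - 1) *\<^sub>R v = (\<sigma> - 1) *\<^sub>R x 0 - (\<sigma> - \<alpha>) *\<^sub>R T (x (-1))"
    by (simp add: algebra_simps)
  have "x (k + 1) = ((\<alpha> - 1) / (of_int k + \<sigma>)) *\<^sub>R v
      + (1 - (\<alpha> - 1) / (of_int k + \<sigma>)) *\<^sub>R T (x k)" if "k \<ge> 0" for k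
  proof -
    define s where "s = of_int k + \<sigma>"
    have "s > 0"
      using \<open>\<sigma> > 0\<close> that by (simp add: s_def add_nonneg_pos)
    have "s *\<^sub>R x (k + 1) - (of_int k + 1 + \<sigma> - \<alpha>) *\<^sub>R T (x k) = (\<alpha> - 1) *\<^sub>R v"
      using generated_by_conserved_step[OF assms(4,3) that]
        generated_by_conserved[OF assms(4,3) that] v
      by (simp add: s_def)
    moreover have "of_int k + 1 + \<sigma> - \<alpha> = s - (\<alpha> - 1)"
      by (simp add: s_def)
    ultimately have "s *\<^sub>R x (k + 1) = (\<alpha> - 1) *\<^sub>R v + (s - (\<alpha> - 1)) *\<^sub>R T (x k)"
      by (simp add: diff_eq_eq)
    also have "\<dots> = s *\<^sub>R (((\<alpha> - 1) / s) *\<^sub>R v + (1 - (\<alpha> - 1) / s) *\<^sub>R T (x k))"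
    proof -
      have "s * ((\<alpha> - 1) / s) = \<alpha> - 1" "s * (1 - (\<alpha> - 1) / s) = s - (\<alpha> - 1)"
        using \<open>s > 0\<close> by (simp_all add: field_simps)
      then show ?thesis
        by (simp only: scaleR_add_right scaleR_scaleR)
    qed
    finally show ?thesis
      using \<open>s > 0\<close> by (simp add: s_def)
  qed
  then show ?thesis
    by (simp add: Let_def v_def)
qed

end
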